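(* Let $(\mathcal{G},[\cdot,\cdot],\alpha)$ be a multiplicative Hom-Lie superalgebra over $\mathbb{C}$ and let $\theta\in C^2_\alpha(\mathcal{G},\mathbb{C})$, i.e. $\theta:\mathcal{G}\times\mathcal{G}\to\mathbb{C}$ is a super-skew-symmetric bilinear form with $\theta(\alpha(x),\alpha(y))=\theta(x,y)$ for all $x,y\in\mathcal{G}$. Let $\widetilde{\mathcal{G}}=\widetilde{\mathcal{G}}_0\oplus\widetilde{\mathcal{G}}_1$ with $\widetilde{\mathcal{G}}_0=\mathcal{G}_0\oplus\mathbb{C}$ and $\widetilde{\mathcal{G}}_1=\mathcal{G}_1$, and define $$[(x,s),(y,t)]_\theta=([x,y],\theta(x,y)),\qquad \widetilde{\alpha}(x,s)=(\alpha(x),s)\qquad (x,y\in\mathcal{G},\ s,t\in\mathbb{C}).$$ Then $(\widetilde{\mathcal{G}},[\cdot,\cdot]_\theta,\widetilde{\alpha})$ is a Hom-Lie superalgebra if and only if $\theta$ is a $2$-cocycle, i.e. $\delta^2(\theta)=0$. (The Hom-Lie superalgebra $(\widetilde{\mathcal{G}},[\cdot,\cdot]_\theta,\widetilde{\alpha})$ is called the central extension of $(\mathcal{G},[\cdot,\cdot],\alpha)$ by $\mathbb{C}$.)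
   Context: A Hom-Lie superalgebra is a triple $(\mathcal{G},[\cdot,\cdot],\alpha)$ with $\mathcal{G}=\mathcal{G}_0\oplus\mathcal{G}_1$ a $\mathbb{Z}_2$-graded vector space, $[\cdot,\cdot]$ an even bilinear map and $\alpha$ an even linear self-map such that for all homogeneous $x,y,z$ (with $|x|$ the parity of $x$): $[x,y]=-(-1)^{|x||y|}[y,x]$ and $(-1)^{|x||z|}[\alpha(x),[y,z]]+(-1)^{|z||y|}[\alpha(z),[x,y]]+(-1)^{|y||x|}[\alpha(y),[z,x]]=0$. It is multiplicative if $\alpha([x,y])=[\alpha(x),\alpha(y)]$. A bilinear form $\theta$ is super-skew-symmetric if $\theta(x,y)=-(-1)^{|x||y|}\theta(y,x)$ for homogeneous $x,y$. The scalar coboundary (coefficients in the trivial representation $\mathbb{C}$, i.e. with zero action) is $$\delta^2(\theta)(x_0,x_1,x_2)=-\theta([x_0,x_1],\alpha(x_2))+(-1)^{|x_1||x_2|}\theta([x_0,x_2],\alpha(x_1))+\theta(\alpha(x_0),[x_1,x_2])$$ for homogeneous $x_0,x_1,x_2\in\mathcal{G}$.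
   Formalization: The condition "δ²(θ)=0" is replaced by "θ is even (zero on pairs of opposite parity) and δ²(θ)=0", since for non-even θ the bracket [·,·]_θ is not even and the stated equivalence can fail (e.g. zero bracket, α=id, θ(e0,e1)=1). *)

theory Defs
  imports Complex_Main "HOL-Library.Z2" "HOL-Library.Product_Plus"
begin

text \<open>
  Parities are elements of the field \<open>bit\<close> with two elements, so \<open>i + j\<close> is addition modulo 2.
  A complex superspace is a complex vector space (the whole type, with scalar multiplication
  \<open>scale\<close>) with a grading \<open>gr :: bit \<Rightarrow> 'a set\<close>.  Identities for homogeneous elements are stated
  for all parities \<open>i\<close>, \<open>j\<close> and all \<open>x \<in> gr i\<close>, \<open>y \<in> gr j\<close>, so \<open>i\<close> plays the role of the
  parity of \<open>x\<close>; the vector 0 is homogeneous of both parities.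
\<close>

definition parity_sign :: "bit \<Rightarrow> bit \<Rightarrow> complex" where
  "parity_sign i j = (if i = 1 \<and> j = 1 then -1 else 1)"  \<comment> \<open>\<open>(-1)\<close> to the power \<open>i j\<close>\<close>

locale superspace = vector_space scale
  for scale :: "complex \<Rightarrow> 'a::ab_group_add \<Rightarrow> 'a" +
  fixes gr :: "bit \<Rightarrow> 'a set"
  assumes subspace_gr: "subspace (gr i)"
    and gr_sum: "\<exists>x\<in>gr 0. \<exists>y\<in>gr 1. v = x + y"
    and gr_disjoint: "gr 0 \<inter> gr 1 = {0}"

definition bilinear_map ::
    "(complex \<Rightarrow> 'a::ab_group_add \<Rightarrow> 'a) \<Rightarrow> (complex \<Rightarrow> 'b::ab_group_add \<Rightarrow> 'b) \<Rightarrow>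
      ('a \<Rightarrow> 'a \<Rightarrow> 'b) \<Rightarrow> bool" where
  "bilinear_map sa sb f \<longleftrightarrow>
     (\<forall>x. Vector_Spaces.linear sa sb (\<lambda>y. f x y)) \<and>
     (\<forall>y. Vector_Spaces.linear sa sb (\<lambda>x. f x y))"

definition even_linear :: "(bit \<Rightarrow> 'a set) \<Rightarrow> (bit \<Rightarrow> 'b set) \<Rightarrow> ('a \<Rightarrow> 'b) \<Rightarrow> bool" where
  "even_linear ga gb f \<longleftrightarrow> (\<forall>i. \<forall>x\<in>ga i. f x \<in> gb i)"

definition even_bilinear :: "(bit \<Rightarrow> 'a set) \<Rightarrow> (bit \<Rightarrow> 'b set) \<Rightarrow> ('a \<Rightarrow> 'a \<Rightarrow> 'b) \<Rightarrow> bool" where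
  "even_bilinear ga gb f \<longleftrightarrow> (\<forall>i j. \<forall>x\<in>ga i. \<forall>y\<in>ga j. f x y \<in> gb (i + j))"

locale hom_lie_superalgebra = superspace scale gr
  for scale :: "complex \<Rightarrow> 'a::ab_group_add \<Rightarrow> 'a" and gr :: "bit \<Rightarrow> 'a set" +
  fixes br :: "'a \<Rightarrow> 'a \<Rightarrow> 'a" and \<alpha> :: "'a \<Rightarrow> 'a"
  assumes bilinear_br: "bilinear_map scale scale br"
    and even_br: "even_bilinear gr gr br"
    and linear_\<alpha>: "Vector_Spaces.linear scale scale \<alpha>"
    and even_\<alpha>: "even_linear gr gr \<alpha>"
    and super_skew: "\<lbrakk>x \<in> gr i; y \<in> gr j\<rbrakk> \<Longrightarrow> br x y = - scale (parity_sign i j) (br y x)"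
    and hom_jacobi: "\<lbrakk>x \<in> gr i; y \<in> gr j; z \<in> gr k\<rbrakk> \<Longrightarrow>
        scale (parity_sign i k) (br (\<alpha> x) (br y z)) +
        scale (parity_sign k j) (br (\<alpha> z) (br x y)) +
        scale (parity_sign j i) (br (\<alpha> y) (br z x)) = 0"

locale multiplicative_hom_lie_superalgebra = hom_lie_superalgebra +
  assumes multiplicative: "\<alpha> (br x y) = br (\<alpha> x) (\<alpha> y)"

definition super_skew_symmetric :: "(bit \<Rightarrow> 'a set) \<Rightarrow> ('a \<Rightarrow> 'a \<Rightarrow> complex) \<Rightarrow> bool" where
  "super_skew_symmetric gr \<theta> \<longleftrightarrow>
     (\<forall>i j. \<forall>x\<in>gr i. \<forall>y\<in>gr j. \<theta> x y = - parity_sign i j * \<theta> y x)"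

text \<open>The 2-hom-cochains with values in the complex numbers.  They are not required to be even, i.e. to
  vanish on pairs of elements of different parity; see \<open>even_bilinear\<close> and \<open>gr_complex\<close>.\<close>

definition C2 :: "(complex \<Rightarrow> 'a::ab_group_add \<Rightarrow> 'a) \<Rightarrow> (bit \<Rightarrow> 'a set) \<Rightarrow> ('a \<Rightarrow> 'a) \<Rightarrow>
    ('a \<Rightarrow> 'a \<Rightarrow> complex) set" where
  "C2 scale gr \<alpha> =
     {\<theta>. bilinear_map scale (*) \<theta> \<and> super_skew_symmetric gr \<theta> \<and> (\<forall>x y. \<theta> (\<alpha> x) (\<alpha> y) = \<theta> x y)}"

text \<open>In \<open>\<delta>2\<close> the arguments \<open>i1\<close>, \<open>i2\<close> are the parities of \<open>x1\<close>, \<open>x2\<close>.\<close>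

definition \<delta>2 :: "('a \<Rightarrow> 'a \<Rightarrow> 'a) \<Rightarrow> ('a \<Rightarrow> 'a) \<Rightarrow> ('a \<Rightarrow> 'a \<Rightarrow> complex) \<Rightarrow>
    bit \<Rightarrow> bit \<Rightarrow> 'a \<Rightarrow> 'a \<Rightarrow> 'a \<Rightarrow> complex" where
  "\<delta>2 br \<alpha> \<theta> i1 i2 x0 x1 x2 =
     - \<theta> (br x0 x1) (\<alpha> x2) + parity_sign i1 i2 * \<theta> (br x0 x2) (\<alpha> x1) + \<theta> (\<alpha> x0) (br x1 x2)"

definition \<delta>2_vanishes :: "(bit \<Rightarrow> 'a set) \<Rightarrow> ('a \<Rightarrow> 'a \<Rightarrow> 'a) \<Rightarrow> ('a \<Rightarrow> 'a) \<Rightarrow>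
    ('a \<Rightarrow> 'a \<Rightarrow> complex) \<Rightarrow> bool" where
  "\<delta>2_vanishes gr br \<alpha> \<theta> \<longleftrightarrow>
     (\<forall>i0 i1 i2. \<forall>x0\<in>gr i0. \<forall>x1\<in>gr i1. \<forall>x2\<in>gr i2. \<delta>2 br \<alpha> \<theta> i1 i2 x0 x1 x2 = 0)"

text \<open>The complex numbers as a superspace concentrated in parity 0.\<close>

definition gr_complex :: "bit \<Rightarrow> complex set" where
  "gr_complex i = (if i = 0 then UNIV else {0})"

definition ext_scale :: "(complex \<Rightarrow> 'a \<Rightarrow> 'a) \<Rightarrow> complex \<Rightarrow> 'a \<times> complex \<Rightarrow> 'a \<times> complex" where
  "ext_scale scale c = (\<lambda>(x, s). (scale c x, c * s))"

definition ext_gr :: "(bit \<Rightarrow> 'a set) \<Rightarrow> bit \<Rightarrow> ('a \<times> complex) set" where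
  "ext_gr gr i = gr i \<times> gr_complex i"

definition ext_br :: "('a \<Rightarrow> 'a \<Rightarrow> 'a) \<Rightarrow> ('a \<Rightarrow> 'a \<Rightarrow> complex) \<Rightarrow>
    'a \<times> complex \<Rightarrow> 'a \<times> complex \<Rightarrow> 'a \<times> complex" where
  "ext_br br \<theta> = (\<lambda>(x, s) (y, t). (br x y, \<theta> x y))"

definition ext_\<alpha> :: "('a \<Rightarrow> 'a) \<Rightarrow> 'a \<times> complex \<Rightarrow> 'a \<times> complex" where
  "ext_\<alpha> \<alpha> = (\<lambda>(x, s). (\<alpha> x, s))"

end

theory Submission
  imports Defs
begin

text \<open>The first component of every axiom for the extension is the same axiom for the given algebra.
  In the second component, evenness of the bracket is evenness of \<open>\<theta>\<close>, and super-skew-symmetry turns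
  the cyclic sum of the Hom-Jacobi identity into a sign times \<open>\<delta>2\<close> of \<open>\<theta>\<close>.\<close>

lemma parity_sign_square: "parity_sign i j * parity_sign i j = 1"
  by (simp add: parity_sign_def)

text \<open>The exponent \<open>i (j + k)\<close> is additive in the second factor. Since a bracket
  has the sum of the parities of its entries, this splits the sign for moving an element past a
  bracket.\<close>

lemma parity_sign_add_right: "parity_sign i (j + k) = parity_sign i j * parity_sign i k"
  by (cases i; cases j; cases k) (simp_all add: parity_sign_def)

lemma super_skew_symmetricD:
  "\<lbrakk>super_skew_symmetric gr \<theta>; x \<in> gr i; y \<in> gr j\<rbrakk> \<Longrightarrow> \<theta> x y = - parity_sign i j * \<theta> y x"
  unfolding super_skew_symmetric_def by blast

lemma vector_space_ext_scale:
  assumes "vector_space scale"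
  shows "vector_space (ext_scale scale)"
proof -
  interpret vector_space scale by fact
  show ?thesis
    by unfold_locales (auto simp: ext_scale_def scale_right_distrib scale_left_distrib algebra_simps)
qed

lemma superspace_ext:
  assumes "superspace scale gr"
  shows "superspace (ext_scale scale) (ext_gr gr)"
proof -
  interpret superspace scale gr by fact
  \<comment> \<open>With the vector space part in place, only the three grading axioms remain to be
    shown.\<close>
  interpret ext: vector_space "ext_scale scale"
    by (rule vector_space_ext_scale) (rule vector_space_axioms)
  show ?thesis
  proof
    fix i
    show "ext.subspace (ext_gr gr i)"
      using subspace_gr[of i] unfolding ext.subspace_def subspace_def
      by (auto simp: ext_gr_def gr_complex_def ext_scale_def zero_prod_def)
  next
    fix v :: "'a \<times> complex"
    obtain w s where v: "v = (w, s)" by (cases v)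
    obtain x y where "x \<in> gr 0" "y \<in> gr 1" "w = x + y" using gr_sum by blast
    \<comment> \<open>The scalars have parity 0, so all of \<open>s\<close> goes to the even
      summand.\<close>
    then have "(x, s) \<in> ext_gr gr 0" "(y, 0) \<in> ext_gr gr 1" "v = (x, s) + (y, 0)"
      by (auto simp: v ext_gr_def gr_complex_def)
    then show "\<exists>x\<in>ext_gr gr 0. \<exists>y\<in>ext_gr gr 1. v = x + y" by blast
  next
    show "ext_gr gr 0 \<inter> ext_gr gr 1 = {0}"
      using gr_disjoint by (auto simp: ext_gr_def gr_complex_def zero_prod_def)
  qed
qed

lemma bilinear_map_ext_br:
  assumes "bilinear_map scale scale br" and "bilinear_map scale (*) \<theta>"
  shows "bilinear_map (ext_scale scale) (ext_scale scale) (ext_br br \<theta>)"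
  using assms unfolding bilinear_map_def Vector_Spaces.linear_iff
  by (auto simp: vector_space_ext_scale ext_br_def ext_scale_def)

lemma linear_ext_\<alpha>:
  assumes "Vector_Spaces.linear scale scale \<alpha>"
  shows "Vector_Spaces.linear (ext_scale scale) (ext_scale scale) (ext_\<alpha> \<alpha>)"
  using assms unfolding Vector_Spaces.linear_iff
  by (auto simp: vector_space_ext_scale ext_\<alpha>_def ext_scale_def)

lemma even_linear_ext_\<alpha>:
  "even_linear gr gr \<alpha> \<Longrightarrow> even_linear (ext_gr gr) (ext_gr gr) (ext_\<alpha> \<alpha>)"
  by (auto simp: even_linear_def ext_gr_def ext_\<alpha>_def)

text \<open>An odd vector of the extension has scalar component 0, so a bracket of elements of
  opposite parity is odd only if \<open>\<theta>\<close> vanishes on them. For equal parities the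
  scalar is unrestricted.\<close>

lemma even_bilinear_ext_br_iff:
  assumes "even_bilinear gr gr br"
  shows "even_bilinear (ext_gr gr) (ext_gr gr) (ext_br br \<theta>) \<longleftrightarrow> even_bilinear gr gr_complex \<theta>"
proof
  assume *: "even_bilinear (ext_gr gr) (ext_gr gr) (ext_br br \<theta>)"
  show "even_bilinear gr gr_complex \<theta>"
    unfolding even_bilinear_def
  proof (intro allI ballI)
    fix i j x y assume "x \<in> gr i" "y \<in> gr j"
    \<comment> \<open>The scalar 0 is homogeneous of both parities, so \<open>(x, 0)\<close> lifts
      \<open>x\<close> whatever its parity.\<close>
    then have "(x, 0) \<in> ext_gr gr i" "(y, 0) \<in> ext_gr gr j"
      by (auto simp: ext_gr_def gr_complex_def)
    with * have "ext_br br \<theta> (x, 0) (y, 0) \<in> ext_gr gr (i + j)"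
      unfolding even_bilinear_def by blast
    then show "\<theta> x y \<in> gr_complex (i + j)" by (simp add: ext_br_def ext_gr_def)
  qed
next
  assume "even_bilinear gr gr_complex \<theta>"
  with assms show "even_bilinear (ext_gr gr) (ext_gr gr) (ext_br br \<theta>)"
    unfolding even_bilinear_def ext_br_def ext_gr_def by auto
qed

context hom_lie_superalgebra
begin

lemma super_skew_ext:
  assumes "super_skew_symmetric gr \<theta>" and "u \<in> ext_gr gr i" and "v \<in> ext_gr gr j"
  shows "ext_br br \<theta> u v = - ext_scale scale (parity_sign i j) (ext_br br \<theta> v u)"
proof -
  obtain x s y t where uv: "u = (x, s)" "v = (y, t)" by (cases u, cases v)
  then have xy: "x \<in> gr i" "y \<in> gr j" using assms(2,3) by (auto simp: ext_gr_def)
  show ?thesis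
    unfolding uv ext_br_def ext_scale_def
    \<comment> \<open>Both skew-symmetries are read from right to left, one in each component;
      \<open>simplified\<close> pulls the minus sign out of the product to match the goal.\<close>
    by (simp flip: super_skew[OF xy] super_skew_symmetricD[OF assms(1) xy, simplified])
qed

text \<open>The first summand already has the shape of the last term of \<open>\<delta>2\<close>.
  Swapping the entries of the second leaves the sign \<open>- parity_sign i k\<close>. In the third,
  the entries of \<open>\<theta>\<close> and those of the inner bracket are both swapped: the two
  minus signs cancel and \<open>parity_sign i k * parity_sign j k\<close> is left.\<close>

lemma cyclic_sum_eq_\<delta>2:
  assumes "bilinear_map scale (*) \<theta>" and skew: "super_skew_symmetric gr \<theta>"
    and x: "x \<in> gr i" and y: "y \<in> gr j" and z: "z \<in> gr k"
  shows "parity_sign i k * \<theta> (\<alpha> x) (br y z) + parity_sign k j * \<theta> (\<alpha> z) (br x y)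
      + parity_sign j i * \<theta> (\<alpha> y) (br z x) = parity_sign i k * \<delta>2 br \<alpha> \<theta> j k x y z"
proof -
  have \<theta>_scale: "\<theta> (scale c u) w = c * \<theta> u w" for c u w
    using assms(1) by (simp add: bilinear_map_def Vector_Spaces.linear_iff)
  have \<theta>_minus: "\<theta> (- u) w = - \<theta> u w" for u w
    using \<theta>_scale[of "-1" u w] by simp
  \<comment> \<open>Super-skew-symmetry applies only to entries of known parity; evenness of
    \<open>\<alpha>\<close> and of the bracket provides it.\<close>
  have \<alpha>: "\<alpha> y \<in> gr j" "\<alpha> z \<in> gr k"
    using even_\<alpha> y z by (auto simp: even_linear_def)
  have br: "br x y \<in> gr (i + j)" "br z x \<in> gr (k + i)"
    using even_br x y z unfolding even_bilinear_def by blast+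
  have "\<theta> (\<alpha> z) (br x y) = - parity_sign k (i + j) * \<theta> (br x y) (\<alpha> z)"
    by (rule super_skew_symmetricD[OF skew \<alpha>(2) br(1)])
  moreover have "\<theta> (\<alpha> y) (br z x) = parity_sign j (k + i) * parity_sign k i * \<theta> (br x z) (\<alpha> y)"
    using super_skew_symmetricD[OF skew \<alpha>(1) br(2)] super_skew[OF z x]
    by (simp add: \<theta>_minus \<theta>_scale)
  ultimately show ?thesis
    \<comment> \<open>Only signs of pairs of parities are left, and a case split on them settles the
      identity.\<close>
    unfolding \<delta>2_def parity_sign_add_right by (auto simp: parity_sign_def)
qed

text \<open>The bracket discards scalar components, so \<open>r\<close>, \<open>s\<close>,
  \<open>t\<close> are arbitrary. One equation thus serves both directions of the equivalence: lifts
  with scalar 0 in one, general homogeneous elements in the other.\<close>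

lemma jacobi_ext:
  assumes "bilinear_map scale (*) \<theta>" and "super_skew_symmetric gr \<theta>"
    and "x \<in> gr i" and "y \<in> gr j" and "z \<in> gr k"
  shows "ext_scale scale (parity_sign i k) (ext_br br \<theta> (ext_\<alpha> \<alpha> (x, r)) (ext_br br \<theta> (y, s) (z, t))) +
      ext_scale scale (parity_sign k j) (ext_br br \<theta> (ext_\<alpha> \<alpha> (z, t)) (ext_br br \<theta> (x, r) (y, s))) +
      ext_scale scale (parity_sign j i) (ext_br br \<theta> (ext_\<alpha> \<alpha> (y, s)) (ext_br br \<theta> (z, t) (x, r)))
    = (0, parity_sign i k * \<delta>2 br \<alpha> \<theta> j k x y z)"
  using hom_jacobi[OF assms(3-5)] cyclic_sum_eq_\<delta>2[OF assms]
  by (simp add: ext_scale_def ext_br_def ext_\<alpha>_def)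

lemma hom_lie_superalgebra_ext_iff:
  assumes bil: "bilinear_map scale (*) \<theta>" and skew: "super_skew_symmetric gr \<theta>"
  shows "hom_lie_superalgebra (ext_scale scale) (ext_gr gr) (ext_br br \<theta>) (ext_\<alpha> \<alpha>)
    \<longleftrightarrow> even_bilinear gr gr_complex \<theta> \<and> \<delta>2_vanishes gr br \<alpha> \<theta>"
proof
  assume "hom_lie_superalgebra (ext_scale scale) (ext_gr gr) (ext_br br \<theta>) (ext_\<alpha> \<alpha>)"
  then interpret ext: hom_lie_superalgebra "ext_scale scale" "ext_gr gr" "ext_br br \<theta>" "ext_\<alpha> \<alpha>" .
  have "\<delta>2 br \<alpha> \<theta> j k x y z = 0" if xyz: "x \<in> gr i" "y \<in> gr j" "z \<in> gr k" for i j k x y z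
  proof -
    have "(x, 0) \<in> ext_gr gr i" "(y, 0) \<in> ext_gr gr j" "(z, 0) \<in> ext_gr gr k"
      using xyz by (auto simp: ext_gr_def gr_complex_def)
    from ext.hom_jacobi[OF this] have "parity_sign i k * \<delta>2 br \<alpha> \<theta> j k x y z = 0"
      unfolding jacobi_ext[OF bil skew xyz] by (simp add: zero_prod_def)
    \<comment> \<open>A sign squares to 1, so it is nonzero and can be cancelled.\<close>
    then show ?thesis using parity_sign_square[of i k] by auto
  qed
  then show "even_bilinear gr gr_complex \<theta> \<and> \<delta>2_vanishes gr br \<alpha> \<theta>"
    using ext.even_br even_bilinear_ext_br_iff[OF even_br] unfolding \<delta>2_vanishes_def by blast
next
  assume \<theta>: "even_bilinear gr gr_complex \<theta> \<and> \<delta>2_vanishes gr br \<alpha> \<theta>"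
  show "hom_lie_superalgebra (ext_scale scale) (ext_gr gr) (ext_br br \<theta>) (ext_\<alpha> \<alpha>)"
  proof (intro hom_lie_superalgebra.intro hom_lie_superalgebra_axioms.intro)
    show "superspace (ext_scale scale) (ext_gr gr)"
      by (rule superspace_ext) (rule superspace_axioms)
    show "bilinear_map (ext_scale scale) (ext_scale scale) (ext_br br \<theta>)"
      by (rule bilinear_map_ext_br[OF bilinear_br bil])
    show "even_bilinear (ext_gr gr) (ext_gr gr) (ext_br br \<theta>)"
      using \<theta> even_bilinear_ext_br_iff[OF even_br] by blast
    show "Vector_Spaces.linear (ext_scale scale) (ext_scale scale) (ext_\<alpha> \<alpha>)"
      by (rule linear_ext_\<alpha>[OF linear_\<alpha>])
    show "even_linear (ext_gr gr) (ext_gr gr) (ext_\<alpha> \<alpha>)"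
      by (rule even_linear_ext_\<alpha>[OF even_\<alpha>])
  next
    fix u v i j assume "u \<in> ext_gr gr i" "v \<in> ext_gr gr j"
    then show "ext_br br \<theta> u v = - ext_scale scale (parity_sign i j) (ext_br br \<theta> v u)"
      by (rule super_skew_ext[OF skew])
  next
    fix u v w i j k assume uvw: "u \<in> ext_gr gr i" "v \<in> ext_gr gr j" "w \<in> ext_gr gr k"
    obtain x r y s z t where eq: "u = (x, r)" "v = (y, s)" "w = (z, t)"
      by (cases u, cases v, cases w)
    have xyz: "x \<in> gr i" "y \<in> gr j" "z \<in> gr k" using uvw by (auto simp: eq ext_gr_def)
    then have "\<delta>2 br \<alpha> \<theta> j k x y z = 0" using \<theta> unfolding \<delta>2_vanishes_def by blast
    then show "ext_scale scale (parity_sign i k) (ext_br br \<theta> (ext_\<alpha> \<alpha> u) (ext_br br \<theta> v w)) +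
        ext_scale scale (parity_sign k j) (ext_br br \<theta> (ext_\<alpha> \<alpha> w) (ext_br br \<theta> u v)) +
        ext_scale scale (parity_sign j i) (ext_br br \<theta> (ext_\<alpha> \<alpha> v) (ext_br br \<theta> w u)) = 0"
      unfolding eq jacobi_ext[OF bil skew xyz] by (simp add: zero_prod_def)
  qed
qed

end

text \<open>Evenness of \<open>\<theta>\<close> is a separate conjunct because the cocycle condition
  does not imply it: for the zero bracket every cochain is a cocycle, including forms that pair even
  with odd elements nontrivially.\<close>

theorem theorem4p1:
  fixes scale :: "complex \<Rightarrow> 'a::ab_group_add \<Rightarrow> 'a"
    and gr :: "bit \<Rightarrow> 'a set"
    and br :: "'a \<Rightarrow> 'a \<Rightarrow> 'a"
    and \<alpha> :: "'a \<Rightarrow> 'a"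
    and \<theta> :: "'a \<Rightarrow> 'a \<Rightarrow> complex"
  assumes "multiplicative_hom_lie_superalgebra scale gr br \<alpha>"
    and "\<theta> \<in> C2 scale gr \<alpha>"
  shows "hom_lie_superalgebra (ext_scale scale) (ext_gr gr) (ext_br br \<theta>) (ext_\<alpha> \<alpha>)
    \<longleftrightarrow> even_bilinear gr gr_complex \<theta> \<and> \<delta>2_vanishes gr br \<alpha> \<theta>"
proof -
  interpret multiplicative_hom_lie_superalgebra scale gr br \<alpha> by fact
  show ?thesis
    using assms(2) by (intro hom_lie_superalgebra_ext_iff) (auto simp: C2_def)
qed

end
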